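(* The two linear forms $f\mapsto\int_\Omega\partial_xf\,\overline{\Phi^0}$ and $f\mapsto\int_\Omega\partial_xf\,\overline{\Phi^1}$ are linearly independent on $C^\infty_c(\Omega)$.
   Context: Fix $x_0<x_1$, $\Omega=(x_0,x_1)\times(-1,1)$, coordinates $(x,z)$, $\Omega_\pm=\Omega\cap\{\pm z>0\}$, jumps $[g]_{z=0}(x)=g(x,0^+)-g(x,0^-)$. $Z^0(\mathcal O)$: functions with $\phi,\partial_z\phi,\partial_{zz}\phi,z\partial_x\phi\in L^2(\mathcal O)$. Dual profiles: for $j\in\{0,1\}$, $\overline{\Phi^j}$ is the unique function with $\overline{\Phi^j}_{|\Omega_\pm}\in Z^0(\Omega_\pm)$, $-z\partial_x\overline{\Phi^j}-\partial_{zz}\overline{\Phi^j}=0$ in $\Omega_\pm$, $[\overline{\Phi^j}]_{z=0}=\mathbf 1_{j=1}$, $[\partial_z\overline{\Phi^j}]_{z=0}=-\mathbf 1_{j=0}$, and $\overline{\Phi^j}=0$ on $\{x_0\}\times(-1,0)$, $\{x_1\}\times(0,1)$ and $\{z=\pm1\}$. *)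

theory Defs
  imports "HOL-Analysis.Analysis"
begin

definition Omega :: "real \<Rightarrow> real \<Rightarrow> (real \<times> real) set" where
  "Omega x0 x1 = {x0<..<x1} \<times> {-1<..<1}"

definition Omega_plus :: "real \<Rightarrow> real \<Rightarrow> (real \<times> real) set" where
  "Omega_plus x0 x1 = {x0<..<x1} \<times> {0<..<1}"

definition Omega_minus :: "real \<Rightarrow> real \<Rightarrow> (real \<times> real) set" where
  "Omega_minus x0 x1 = {x0<..<x1} \<times> {-1<..<0}"

definition partial_x :: "(real \<times> real \<Rightarrow> real) \<Rightarrow> real \<times> real \<Rightarrow> real" where
  "partial_x f p = deriv (\<lambda>t. f (t, snd p)) (fst p)"

definition partial_z :: "(real \<times> real \<Rightarrow> real) \<Rightarrow> real \<times> real \<Rightarrow> real" where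
  "partial_z f p = deriv (\<lambda>t. f (fst p, t)) (snd p)"

coinductive smooth2 :: "(real \<times> real \<Rightarrow> real) \<Rightarrow> bool" where
  "\<lbrakk>\<forall>p. f differentiable (at p); smooth2 (partial_x f); smooth2 (partial_z f)\<rbrakk> \<Longrightarrow> smooth2 f"

definition test_fun :: "(real \<times> real) set \<Rightarrow> (real \<times> real \<Rightarrow> real) \<Rightarrow> bool" where
  "test_fun U \<phi> \<longleftrightarrow> smooth2 \<phi> \<and> compact (closure {p. \<phi> p \<noteq> 0}) \<and> closure {p. \<phi> p \<noteq> 0} \<subseteq> U"

definition L2_on :: "(real \<times> real) set \<Rightarrow> (real \<times> real \<Rightarrow> real) \<Rightarrow> bool" where
  "L2_on U f \<longleftrightarrow> set_borel_measurable lborel U f \<and> set_integrable lborel U (\<lambda>p. (f p)\<^sup>2)"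

definition weak_dx :: "(real \<times> real) set \<Rightarrow> (real \<times> real \<Rightarrow> real) \<Rightarrow> (real \<times> real \<Rightarrow> real) \<Rightarrow> bool" where
  "weak_dx U f g \<longleftrightarrow> (\<forall>\<phi>. test_fun U \<phi> \<longrightarrow>
     (LINT p:U|lborel. f p * partial_x \<phi> p) = - (LINT p:U|lborel. g p * \<phi> p))"

definition weak_dz :: "(real \<times> real) set \<Rightarrow> (real \<times> real \<Rightarrow> real) \<Rightarrow> (real \<times> real \<Rightarrow> real) \<Rightarrow> bool" where
  "weak_dz U f g \<longleftrightarrow> (\<forall>\<phi>. test_fun U \<phi> \<longrightarrow>
     (LINT p:U|lborel. f p * partial_z \<phi> p) = - (LINT p:U|lborel. g p * \<phi> p))"

definition Z0 :: "(real \<times> real) set \<Rightarrow> (real \<times> real \<Rightarrow> real) \<Rightarrow> bool" where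
  "Z0 U \<phi> \<longleftrightarrow> L2_on U \<phi> \<and>
     (\<exists>gz gzz gx. weak_dz U \<phi> gz \<and> L2_on U gz \<and> weak_dz U gz gzz \<and> L2_on U gzz \<and>
        weak_dx U \<phi> gx \<and> set_borel_measurable lborel U gx \<and> L2_on U (\<lambda>p. snd p * gx p))"

text \<open>-z \<partial>_x \<Phi> - \<partial>_zz \<Phi> = 0 in the sense of distributions on U.\<close>
definition kolmogorov_sol :: "(real \<times> real) set \<Rightarrow> (real \<times> real \<Rightarrow> real) \<Rightarrow> bool" where
  "kolmogorov_sol U \<Phi> \<longleftrightarrow> (\<forall>\<psi>. test_fun U \<psi> \<longrightarrow>
     (LINT p:U|lborel. \<Phi> p * (snd p * partial_x \<psi> p - partial_z (partial_z \<psi>) p)) = 0)"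

text \<open>Dual profile \<Phi>^j (j = 0,1). Traces are taken as one-sided limits along coordinate lines
  (for almost every line) of the given representative \<Phi>.\<close>
definition dual_profile :: "real \<Rightarrow> real \<Rightarrow> nat \<Rightarrow> (real \<times> real \<Rightarrow> real) \<Rightarrow> bool" where
  "dual_profile x0 x1 j \<Phi> \<longleftrightarrow>
     Z0 (Omega_plus x0 x1) \<Phi> \<and> Z0 (Omega_minus x0 x1) \<Phi> \<and>
     kolmogorov_sol (Omega_plus x0 x1) \<Phi> \<and> kolmogorov_sol (Omega_minus x0 x1) \<Phi> \<and>
     (AE x in lborel. x0 < x \<and> x < x1 \<longrightarrow>
        (\<exists>a b c d.
           ((\<lambda>z. \<Phi> (x, z)) \<longlongrightarrow> a) (at_right 0) \<and>
           ((\<lambda>z. \<Phi> (x, z)) \<longlongrightarrow> b) (at_left 0) \<and>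
           (\<forall>z \<in> {0<..<1} \<union> {-1<..<0}. (\<lambda>z. \<Phi> (x, z)) differentiable (at z)) \<and>
           ((\<lambda>z. deriv (\<lambda>z. \<Phi> (x, z)) z) \<longlongrightarrow> c) (at_right 0) \<and>
           ((\<lambda>z. deriv (\<lambda>z. \<Phi> (x, z)) z) \<longlongrightarrow> d) (at_left 0) \<and>
           a - b = (if j = 1 then 1 else 0) \<and>
           c - d = (if j = 0 then -1 else 0) \<and>
           ((\<lambda>z. \<Phi> (x, z)) \<longlongrightarrow> 0) (at_left 1) \<and>
           ((\<lambda>z. \<Phi> (x, z)) \<longlongrightarrow> 0) (at_right (-1)))) \<and>
     (AE z in lborel. -1 < z \<and> z < 0 \<longrightarrow> ((\<lambda>x. \<Phi> (x, z)) \<longlongrightarrow> 0) (at_right x0)) \<and>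
     (AE z in lborel. 0 < z \<and> z < 1 \<longrightarrow> ((\<lambda>x. \<Phi> (x, z)) \<longlongrightarrow> 0) (at_left x1))"

definition dual_form :: "real \<Rightarrow> real \<Rightarrow> (real \<times> real \<Rightarrow> real) \<Rightarrow> (real \<times> real \<Rightarrow> real) \<Rightarrow> real" where
  "dual_form x0 x1 \<Phi> f = (LINT p:Omega x0 x1|lborel. partial_x f p * \<Phi> p)"

end

theory Submission
  imports Defs
begin

text \<open>Let \<open>\<Phi> = a \<Phi>\<^sup>0 + b \<Phi>\<^sup>1\<close> and suppose that \<open>\<integral> \<partial>\<^sub>xf \<Phi> = 0\<close> for all test functions.
  Taking \<open>f(x,z) = (G(x) - G(x-s)) \<eta>(z)\<close> with bump functions \<open>G'\<close> and \<open>\<eta>\<close> shows that on each half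
  \<open>\<Phi>(x+s,z) = \<Phi>(x,z)\<close> almost everywhere, simultaneously for all rational \<open>s\<close>. Letting \<open>x+s\<close> tend to
  the lateral end where \<open>\<Phi>\<close> has zero trace (\<open>x\<^sub>0\<close> for \<open>z < 0\<close>, \<open>x\<^sub>1\<close> for \<open>z > 0\<close>) gives \<open>\<Phi> = 0\<close> almost everywhere.
  On almost every vertical line \<open>\<Phi>\<close> is continuous off \<open>z = 0\<close>, hence vanishes there, and its jumps
  \<open>[\<Phi>] = b\<close> and \<open>[\<partial>\<^sub>z\<Phi>] = -a\<close> are zero.\<close>

section \<open>Smooth functions of one real variable\<close>

text \<open>Counting derivatives turns closure under sums, products and affine substitutions into
  inductions on \<open>n\<close>; \<open>smooth2_product\<close> passes from this notion to the
  coinductive one.\<close>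

primrec times_differentiable :: "nat \<Rightarrow> (real \<Rightarrow> real) \<Rightarrow> bool" where
  "times_differentiable 0 f = True"
| "times_differentiable (Suc n) f = ((\<forall>x. f differentiable at x) \<and> times_differentiable n (deriv f))"

definition smooth1 :: "(real \<Rightarrow> real) \<Rightarrow> bool" where
  "smooth1 f \<longleftrightarrow> (\<forall>n. times_differentiable n f)"

lemma real_derivative_differentiable:
  "(f has_real_derivative D) (at x) \<Longrightarrow> f differentiable at x"
  by (auto simp: real_differentiable_def)

lemma times_differentiable_SucD: "times_differentiable (Suc n) f \<Longrightarrow> times_differentiable n f"
  by (induction n arbitrary: f) auto

lemma smooth1_iff: "smooth1 f \<longleftrightarrow> (\<forall>x. f differentiable at x) \<and> smooth1 (deriv f)"
  unfolding smooth1_def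
  by (metis times_differentiable.simps(2) times_differentiable_SucD)

lemma smooth1_has_derivative:
  assumes "smooth1 f" shows "(f has_real_derivative deriv f x) (at x)"
  using assms smooth1_iff DERIV_deriv_iff_real_differentiable by blast

lemma smooth1I:
  assumes "\<And>x. (f has_real_derivative f' x) (at x)" "smooth1 f'"
  shows "smooth1 f"
proof -
  have "deriv f = f'" using assms(1) by (auto intro: DERIV_imp_deriv)
  then show ?thesis
    using assms by (metis smooth1_iff real_derivative_differentiable)
qed

lemma times_differentiable_add:
  "times_differentiable n f \<Longrightarrow> times_differentiable n g \<Longrightarrow> times_differentiable n (\<lambda>x. f x + g x)"
proof (induction n arbitrary: f g)
  case (Suc n)
  then have "((\<lambda>x. f x + g x) has_real_derivative deriv f x + deriv g x) (at x)" for x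
    by (auto intro!: DERIV_add simp: DERIV_deriv_iff_real_differentiable)
  moreover from this have "deriv (\<lambda>x. f x + g x) = (\<lambda>x. deriv f x + deriv g x)"
    by (auto intro: DERIV_imp_deriv)
  ultimately show ?case using Suc by (auto intro: real_derivative_differentiable)
qed auto

lemma times_differentiable_mult:
  "times_differentiable n f \<Longrightarrow> times_differentiable n g \<Longrightarrow> times_differentiable n (\<lambda>x. f x * g x)"
proof (induction n arbitrary: f g)
  case (Suc n)
  then have *: "((\<lambda>x. f x * g x) has_real_derivative deriv f x * g x + deriv g x * f x) (at x)" for x
    by (intro DERIV_mult) (auto simp: DERIV_deriv_iff_real_differentiable)
  then have "deriv (\<lambda>x. f x * g x) = (\<lambda>x. deriv f x * g x + deriv g x * f x)"
    by (auto intro: DERIV_imp_deriv)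
  \<comment> \<open>The product rule keeps undifferentiated factors \<open>f\<close> and
    \<open>g\<close>, so they enter the induction hypothesis with their order lowered by
    one.\<close>
  moreover have "times_differentiable n (\<lambda>x. deriv f x * g x + deriv g x * f x)"
    using Suc times_differentiable_SucD[of n f] times_differentiable_SucD[of n g]
    by (intro times_differentiable_add Suc.IH) auto
  ultimately show ?case using * by (auto intro: real_derivative_differentiable)
qed auto

text \<open>The factor \<open>k\<close> is arbitrary in the induction because each differentiation
  turns it into \<open>k * c\<close>.\<close>

lemma times_differentiable_affine:
  "times_differentiable n f \<Longrightarrow> times_differentiable n (\<lambda>x. k * f (c * x + d))"
proof (induction n arbitrary: f k)
  case (Suc n)
  then have f: "(f has_real_derivative deriv f x) (at x)" for x
    by (auto simp: DERIV_deriv_iff_real_differentiable)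
  have *: "((\<lambda>x. k * f (c * x + d)) has_real_derivative (k * c) * deriv f (c * x + d)) (at x)" for x
    by (rule derivative_eq_intros DERIV_chain2[OF f] | simp)+
  then have "deriv (\<lambda>x. k * f (c * x + d)) = (\<lambda>x. (k * c) * deriv f (c * x + d))"
    by (auto intro: DERIV_imp_deriv)
  moreover have "\<forall>x. (\<lambda>x. k * f (c * x + d)) differentiable at x"
    using * real_derivative_differentiable by blast
  ultimately show ?case using Suc by auto
qed auto

lemma smooth1_mult: "smooth1 f \<Longrightarrow> smooth1 g \<Longrightarrow> smooth1 (\<lambda>x. f x * g x)"
  by (simp add: smooth1_def times_differentiable_mult)

lemma smooth1_add: "smooth1 f \<Longrightarrow> smooth1 g \<Longrightarrow> smooth1 (\<lambda>x. f x + g x)"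
  by (simp add: smooth1_def times_differentiable_add)

lemma smooth1_affine: "smooth1 f \<Longrightarrow> smooth1 (\<lambda>x. k * f (c * x + d))"
  by (simp add: smooth1_def times_differentiable_affine)

section \<open>Compactly supported bump functions\<close>

text \<open>This family is closed under differentiation and contains the classical flat function,
  exp(-1/x) extended by 0, as \<open>exp_poly 1\<close>.\<close>

definition exp_poly :: "real poly \<Rightarrow> real \<Rightarrow> real" where
  "exp_poly p x = (if x > 0 then poly p (inverse x) * exp (- inverse x) else 0)"

lemma tendsto_poly_exp_minus: "((\<lambda>y::real. poly p y * exp (- y)) \<longlongrightarrow> 0) at_top"
proof -
  have "((\<lambda>y::real. \<Sum>i\<le>degree p. coeff p i * (y ^ i / exp y)) \<longlongrightarrow> 0) at_top"
    by (intro tendsto_null_sum tendsto_mult_right_zero tendsto_power_div_exp_0)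
  then show ?thesis
    by (simp add: poly_altdef sum_distrib_right exp_minus divide_inverse mult.assoc)
qed

text \<open>With y = 1/x, differentiating P(y) exp(-y) in x gives the factor -y^2 and replaces P by
  P' - P, hence the new polynomial y^2 (P - P'). At the origin the decay of exp(-y) beats every
  polynomial.\<close>

lemma exp_poly_has_derivative:
  "(exp_poly p has_real_derivative exp_poly ([:0, 0, 1:] * (p - pderiv p)) x) (at x)"
proof -
  consider "x > 0" | "x < 0" | "x = 0" by linarith
  then show ?thesis
  proof cases
    case 1
    have "((\<lambda>x. poly p (inverse x) * exp (- inverse x)) has_real_derivative
        exp_poly ([:0, 0, 1:] * (p - pderiv p)) x) (at x)"
      using 1 unfolding exp_poly_def
      by (auto intro!: derivative_eq_intros DERIV_chain2[OF poly_DERIV]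
          simp: algebra_simps power2_eq_square)
    then show ?thesis
      by (rule DERIV_cong_ev[OF refl _ refl, THEN iffD1, rotated])
        (use 1 in \<open>auto simp: exp_poly_def intro: eventually_mono[OF eventually_nhds_in_open[of "{0<..}"]]\<close>)
  next
    case 2
    have "((\<lambda>x. 0) has_real_derivative exp_poly ([:0, 0, 1:] * (p - pderiv p)) x) (at x)"
      using 2 by (simp add: exp_poly_def)
    then show ?thesis
      by (rule DERIV_cong_ev[OF refl _ refl, THEN iffD1, rotated])
        (use 2 in \<open>auto simp: exp_poly_def intro: eventually_mono[OF eventually_nhds_in_open[of "{..<0}"]]\<close>)
  next
    case 3
    \<comment> \<open>\<open>pCons 0 p\<close> is the polynomial y P(y): the extra y = 1/h is the
      division in the difference quotient.\<close>
    have "((\<lambda>h. poly (pCons 0 p) (inverse h) * exp (- inverse h)) \<longlongrightarrow> 0) (at_right (0::real))"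
      by (rule filterlim_compose[OF tendsto_poly_exp_minus filterlim_inverse_at_top_right])
    then have "((\<lambda>h. exp_poly p h / h) \<longlongrightarrow> 0) (at_right 0)"
      by (rule Lim_transform_eventually)
        (auto simp: exp_poly_def field_simps intro!: eventually_at_right_less[THEN eventually_mono])
    moreover have "((\<lambda>h. exp_poly p h / h) \<longlongrightarrow> 0) (at_left 0)"
      by (rule Lim_transform_eventually[OF tendsto_const])
        (auto simp: exp_poly_def eventually_at intro!: exI[of _ 1])
    ultimately have "((\<lambda>h. exp_poly p h / h) \<longlongrightarrow> 0) (at 0)"
      by (simp add: filterlim_split_at)
    then show ?thesis
      using 3 by (simp add: DERIV_def exp_poly_def)
  qed
qed

lemma smooth1_exp_poly: "smooth1 (exp_poly p)"
proof -
  have "times_differentiable n (exp_poly p)" for n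
  proof (induction n arbitrary: p)
    case (Suc n)
    have "deriv (exp_poly p) = exp_poly ([:0, 0, 1:] * (p - pderiv p))"
      using exp_poly_has_derivative by (auto intro: DERIV_imp_deriv)
    with Suc show ?case
      using exp_poly_has_derivative by (auto intro: real_derivative_differentiable)
  qed auto
  then show ?thesis by (simp add: smooth1_def)
qed

text \<open>For positive \<open>n\<close> the factors vanish unless p + 1/n < x < q - 1/n, so the
  closed support lies inside (p, q). The values stay in [0, 1] and tend to the indicator of (p, q),
  which suits dominated convergence.\<close>

definition bump :: "real \<Rightarrow> real \<Rightarrow> nat \<Rightarrow> real \<Rightarrow> real" where
  "bump p q n x = exp_poly 1 (real n * (x - p) - 1) * exp_poly 1 (real n * (q - x) - 1)"

lemma smooth1_bump: "smooth1 (bump p q n)"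
proof -
  have "bump p q n = (\<lambda>x. (1 * exp_poly 1 (real n * x + (- real n * p - 1))) *
     (1 * exp_poly 1 (- real n * x + (real n * q - 1))))"
    by (auto simp: bump_def algebra_simps)
  then show ?thesis
    by (simp only:) (intro smooth1_mult smooth1_affine smooth1_exp_poly)
qed

lemma bump_nonneg: "0 \<le> bump p q n x" and bump_le_1: "bump p q n x \<le> 1"
  by (auto simp: bump_def exp_poly_def intro!: mult_le_one)

lemma bump_zero:
  assumes "n > 0" "x \<le> p + 1 / n \<or> x \<ge> q - 1 / n"
  shows "bump p q n x = 0"
  using assms by (auto simp: bump_def exp_poly_def field_simps)

lemma tendsto_exp_poly_1:
  assumes "t > 0"
  shows "(\<lambda>n. exp_poly 1 (real n * t - 1)) \<longlonglongrightarrow> 1"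
proof -
  have *: "filterlim (\<lambda>n. real n * t - 1) at_top sequentially"
    using assms filterlim_tendsto_add_at_top[of "\<lambda>_. -1::real" "-1" sequentially "\<lambda>n. real n * t"]
      filterlim_at_top_mult_tendsto_pos[OF tendsto_const assms filterlim_real_sequentially]
    by (simp add: mult.commute)
  have "(\<lambda>n. exp (- inverse (real n * t - 1))) \<longlonglongrightarrow> exp (- 0)"
    by (intro tendsto_intros filterlim_compose[OF tendsto_inverse_0_at_top *] filterlim_ident)
  moreover have "\<forall>\<^sub>F n in sequentially. exp (- inverse (real n * t - 1)) = exp_poly 1 (real n * t - 1)"
    using filterlim_at_top_dense[THEN iffD1, OF *, rule_format, of 0]
    by (auto simp: exp_poly_def elim: eventually_mono)
  ultimately show ?thesis by (simp add: Lim_transform_eventually)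
qed

lemma tendsto_bump: "(\<lambda>n. bump p q n x) \<longlonglongrightarrow> indicator {p<..<q} x"
proof (cases "x \<in> {p<..<q}")
  case True
  then have "(\<lambda>n. bump p q n x) \<longlonglongrightarrow> 1 * 1"
    unfolding bump_def by (intro tendsto_mult tendsto_exp_poly_1) auto
  with True show ?thesis by simp
next
  case False
  have "bump p q n x = 0" if "n > 0" for n
  proof (rule bump_zero[OF that])
    have "1 / real n > 0" using that by simp
    with False show "x \<le> p + 1 / real n \<or> q - 1 / real n \<le> x"
      unfolding greaterThanLessThan_iff by linarith
  qed
  then have "\<forall>\<^sub>F n in sequentially. 0 = bump p q n x"
    by (auto intro: eventually_mono[OF eventually_gt_at_top[of 0]])
  with False show ?thesis by (simp add: Lim_transform_eventually[OF tendsto_const])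
qed

section \<open>Product functions and integrals over boxes\<close>

text \<open>The products g(x) h(z) with smooth factors form a family stable under both partial
  derivatives; membership in it is the invariant of the coinduction.\<close>

lemma smooth2_product:
  assumes "smooth1 g" "smooth1 h"
  shows "smooth2 (\<lambda>p. g (fst p) * h (snd p))"
proof -
  define X where "X f \<longleftrightarrow> (\<exists>g h. smooth1 g \<and> smooth1 h \<and> f = (\<lambda>p. g (fst p) * h (snd p)))"
    for f :: "real \<times> real \<Rightarrow> real"
  have "X (\<lambda>p. g (fst p) * h (snd p))" using assms by (auto simp: X_def)
  then show ?thesis
  proof (coinduct)
    case (smooth2 f)
    then obtain g h where gh: "smooth1 g" "smooth1 h" and f: "f = (\<lambda>p. g (fst p) * h (snd p))"
      by (auto simp: X_def)
    note d = smooth1_has_derivative[OF gh(1)] smooth1_has_derivative[OF gh(2)]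
    have "partial_x f = (\<lambda>p. deriv g (fst p) * h (snd p))"
      unfolding partial_x_def f
      by (auto intro!: DERIV_imp_deriv derivative_eq_intros d)
    moreover have "partial_z f = (\<lambda>p. g (fst p) * deriv h (snd p))"
      unfolding partial_z_def f
      by (auto intro!: DERIV_imp_deriv derivative_eq_intros d)
    moreover have "smooth1 (deriv g)" "smooth1 (deriv h)" using gh smooth1_iff by blast+
    moreover have "f differentiable at p" for p
    proof -
      have "(\<lambda>p. g (fst p)) differentiable at p" "(\<lambda>p. h (snd p)) differentiable at p"
        using differentiable_compose[of g fst p] differentiable_compose[of h snd p] gh smooth1_iff
          bounded_linear_imp_differentiable[OF bounded_linear_fst]
          bounded_linear_imp_differentiable[OF bounded_linear_snd]
        by blast+
      then show ?thesis unfolding f by (rule differentiable_mult)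
    qed
    ultimately show ?case using gh unfolding X_def by blast
  qed
qed

text \<open>Open boxes form an intersection-stable generator of the Borel sets, so a Dynkin argument
  extends the vanishing to all Borel sets; \<open>F\<close> and 0 are then densities with the same
  integrals.\<close>

lemma AE_zero_if_box_integrals_zero:
  fixes F :: "'a::euclidean_space \<Rightarrow> real"
  assumes F: "integrable lborel F"
    and box0: "\<And>a b. (LINT x:box a b|lborel. F x) = 0"
  shows "AE x in lborel. F x = 0"
proof -
  have si: "set_integrable lborel A F" if "A \<in> sets borel" for A
    unfolding set_integrable_def using that integrable_mult_indicator[OF _ F] by simp
  \<comment> \<open>Exhausting the space by centred boxes gives total integral 0, which the
    complement step of the induction needs.\<close>
  have "(\<lambda>n. LINT x:box (- real n *\<^sub>R One) (real n *\<^sub>R One)|lborel. F x) \<longlonglongrightarrow>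
      (LINT x:(\<Union>n. box (- real n *\<^sub>R One) (real n *\<^sub>R One))|lborel. F x)"
    by (rule set_integral_cont_up) (auto simp: incseq_def box_def si intro: order_less_le_trans order_le_less_trans)
  then have tot: "(LINT x:UNIV|lborel. F x) = 0"
    using box0 UN_box_eq_UNIV[where 'a='a] by (simp add: LIMSEQ_const_iff)
  have "(LINT x:A|lborel. F x) = 0" if "A \<in> sets borel" for A
  proof -
    have "Int_stable (range (\<lambda>(a, b). box a b :: 'a set))"
      by (auto simp: Int_stable_def box_Int_box)
    moreover have "range (\<lambda>(a, b). box a b :: 'a set) \<subseteq> Pow UNIV" by auto
    moreover have "A \<in> sigma_sets UNIV (range (\<lambda>(a, b). box a b))"
      using that unfolding borel_eq_box by simp
    ultimately show ?thesis
    proof (induction rule: sigma_sets_induct_disjoint)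
      case (basic A) then show ?case using box0 by auto
    next
      case empty then show ?case by (simp add: set_lebesgue_integral_def)
    next
      case (compl A)
      then have A: "A \<in> sets borel" by (simp add: borel_eq_box)
      have "(LINT x:UNIV - A \<union> A|lborel. F x) = (LINT x:UNIV - A|lborel. F x) + (LINT x:A|lborel. F x)"
        by (rule set_integral_Un) (use A in \<open>auto intro!: si\<close>)
      then show ?case using tot compl by simp
    next
      case (union D)
      then have "\<And>i. D i \<in> sets borel" by (simp add: borel_eq_box subset_eq)
      then have "(LINT x:(\<Union>i. D i)|lborel. F x) = (\<Sum>i. LINT x:D i|lborel. F x)"
        using union by (intro lebesgue_integral_countable_add) (auto simp: disjoint_family_on_def intro!: si)
      then show ?case using union by simp
    qed
  qed
  then show ?thesis
    using density_unique_real[OF F, of "\<lambda>_. 0"] by simp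
qed

section \<open>Invariance under horizontal translations\<close>

text \<open>A primitive \<open>G\<close> of a bump need not have compact support; subtracting the
  translated bump cancels the total mass. The difference G(x) - G(x - s) vanishes once x and x - s
  lie on the same side of the support of the bump.\<close>

lemma bump_shift_antiderivative:
  assumes "n > 0"
  obtains g where "smooth1 g"
    "\<And>x. (g has_real_derivative bump p q n x - bump p q n (x - s)) (at x)"
    "\<And>x. x \<le> min p (p + s) + 1 / n \<or> x \<ge> max q (q + s) - 1 / n \<Longrightarrow> g x = 0"
proof -
  let ?b = "bump p q n"
  have "isCont ?b x" for x
    by (rule DERIV_isCont[OF smooth1_has_derivative[OF smooth1_bump]])
  then obtain G where G: "\<And>x. (G has_real_derivative ?b x) (at x)"
    using einterval_antiderivative[of "-\<infinity>" \<infinity> ?b]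
    by (auto simp: has_real_derivative_iff_has_vector_derivative)
  define g where "g x = G x - G (x - s)" for x
  have G_const: "G u = G v" if "u \<le> p + 1 / n \<and> v \<le> p + 1 / n \<or> u \<ge> q - 1 / n \<and> v \<ge> q - 1 / n" for u v
  proof -
    have *: "G u = G v" if "u < v" "v \<le> p + 1 / n \<or> u \<ge> q - 1 / n" for u v
    proof (rule DERIV_isconst_end[symmetric, OF that(1)])
      show "continuous_on {u..v} G"
        by (intro continuous_at_imp_continuous_on ballI DERIV_isCont[OF G])
      fix x assume "u < x" "x < v"
      then have "?b x = 0" using that(2) by (intro bump_zero assms) auto
      then show "(G has_real_derivative 0) (at x)" using G[of x] by simp
    qed
    then show ?thesis using that by (cases u v rule: linorder_cases) metis+
  qed
  have g': "(g has_real_derivative ?b x - ?b (x - s)) (at x)" for x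
    unfolding g_def by (auto intro!: derivative_eq_intros G DERIV_chain2[OF G])
  have "smooth1 (\<lambda>x. ?b x + (- 1) * ?b (1 * x + (- s)))"
    by (intro smooth1_add smooth1_bump smooth1_affine)
  then have "smooth1 g" by (intro smooth1I[OF g']) simp
  moreover have "g x = 0" if "x \<le> min p (p + s) + 1 / n \<or> x \<ge> max q (q + s) - 1 / n" for x
    unfolding g_def using that by (auto intro!: G_const)
  ultimately show ?thesis using g' by (intro that[of g]) auto
qed

lemma test_fun_product:
  assumes "smooth1 g" "smooth1 h"
    and "\<And>x. g x \<noteq> 0 \<Longrightarrow> x \<in> {a..b}" "\<And>z. h z \<noteq> 0 \<Longrightarrow> z \<in> {c..d}"
    and "{a..b} \<times> {c..d} \<subseteq> U"
  shows "test_fun U (\<lambda>p. g (fst p) * h (snd p))"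
proof -
  have "closure {p. g (fst p) * h (snd p) \<noteq> 0} \<subseteq> {a..b} \<times> {c..d}"
    by (rule closure_minimal) (use assms(3,4) in \<open>force intro!: closed_Times\<close>)+
  moreover have "compact ({a..b} \<times> {c..d})" by (intro compact_Times) auto
  ultimately show ?thesis
    using assms smooth2_product unfolding test_fun_def
    by (meson bounded_subset compact_eq_bounded_closed closed_closure order_trans)
qed

lemma lborel_integral_shift:
  fixes f :: "'a::euclidean_space \<Rightarrow> real"
  assumes "f \<in> borel_measurable borel"
  shows "(LINT p|lborel. f (c + p)) = (LINT p|lborel. f p)"
    and "integrable lborel f \<Longrightarrow> integrable lborel (\<lambda>p. f (c + p))"
proof -
  show "(LINT p|lborel. f (c + p)) = (LINT p|lborel. f p)"
    using integral_distr[of "\<lambda>p. c + p" lborel borel f] assms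
    by (simp add: lborel_distr_plus)
  show "integrable lborel f \<Longrightarrow> integrable lborel (\<lambda>p. f (c + p))"
    using integrable_distr_eq[of "\<lambda>p. c + p" lborel borel f] assms
    by (simp add: lborel_distr_plus)
qed

lemma bump_measurable [measurable]: "bump p q n \<in> borel_measurable borel"
  by (intro borel_measurable_continuous_onI continuous_at_imp_continuous_on ballI
      DERIV_isCont[OF smooth1_has_derivative[OF smooth1_bump]])

text \<open>Testing against \<open>g\<close> times a bump in z gives a difference of integrals with
  the bump taken at x and at x - s; translating by s in the second one moves the shift onto \<Psi>.
  The bounds keep (p, q) and (p + s, q + s) inside (\<alpha>, \<beta>).\<close>

lemma bump_test_shift_integral:
  fixes \<Psi> :: "real \<times> real \<Rightarrow> real"
  assumes \<Psi>: "integrable lborel \<Psi>"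
    and test: "\<And>f. test_fun ({\<alpha><..<\<beta>} \<times> {\<gamma><..<\<delta>}) f \<Longrightarrow> (LINT u|lborel. partial_x f u * \<Psi> u) = 0"
    and bounds: "\<alpha> \<le> p" "\<alpha> \<le> p + s" "q \<le> \<beta>" "q + s \<le> \<beta>" "\<gamma> \<le> c" "d \<le> \<delta>"
    and n: "n > 0"
  shows "(LINT u|lborel. bump p q n (fst u) * bump c d n (snd u) * (\<Psi> u - \<Psi> ((s, 0) + u))) = 0"
proof -
  have [measurable]: "(fst :: real \<times> real \<Rightarrow> real) \<in> borel_measurable borel"
    "(snd :: real \<times> real \<Rightarrow> real) \<in> borel_measurable borel"
    by (intro borel_measurable_continuous_onI continuous_intros)+
  have [measurable]: "\<Psi> \<in> borel_measurable borel" using \<Psi> by simp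
  have bdd: "integrable lborel (\<lambda>u. bump p q n (fst u + r) * bump c d n (snd u) * f u)"
    if "integrable lborel f" for f :: "real \<times> real \<Rightarrow> real" and r
  proof (rule Bochner_Integration.integrable_bound[OF that])
    show "(\<lambda>u. bump p q n (fst u + r) * bump c d n (snd u) * f u) \<in> borel_measurable lborel"
      using borel_measurable_integrable[OF that] by (simp, measurable)
    have "\<bar>bump p q n (fst u + r) * bump c d n (snd u) * f u\<bar> \<le> \<bar>f u\<bar>" for u
      by (simp add: abs_mult bump_nonneg bump_le_1 mult_le_one mult_left_le_one_le)
    then show "AE u in lborel. norm (bump p q n (fst u + r) * bump c d n (snd u) * f u) \<le> norm (f u)"
      by simp
  qed
  obtain g where g: "smooth1 g"
    "\<And>x. (g has_real_derivative bump p q n x - bump p q n (x - s)) (at x)"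
    "\<And>x. x \<le> min p (p + s) + 1 / n \<or> x \<ge> max q (q + s) - 1 / n \<Longrightarrow> g x = 0"
    using bump_shift_antiderivative[OF n] by metis
  let ?f = "\<lambda>u. g (fst u) * bump c d n (snd u)"
  \<comment> \<open>The margin 1/n keeps the closed support strictly inside the open
    rectangle.\<close>
  have "1 / real n > 0" using n by simp
  have "test_fun ({\<alpha><..<\<beta>} \<times> {\<gamma><..<\<delta>}) ?f"
  proof (rule test_fun_product[OF g(1) smooth1_bump])
    show "x \<in> {min p (p + s) + 1 / n..max q (q + s) - 1 / n}" if "g x \<noteq> 0" for x
      using g(3)[of x] that unfolding atLeastAtMost_iff by linarith
    show "z \<in> {c + 1 / n..d - 1 / n}" if "bump c d n z \<noteq> 0" for z
      using bump_zero[OF n, of z c d] that unfolding atLeastAtMost_iff by linarith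
    show "{min p (p + s) + 1 / n..max q (q + s) - 1 / n} \<times> {c + 1 / n..d - 1 / n}
        \<subseteq> {\<alpha><..<\<beta>} \<times> {\<gamma><..<\<delta>}"
      using \<open>1 / real n > 0\<close> bounds
      by (intro Sigma_mono subsetI; unfold atLeastAtMost_iff greaterThanLessThan_iff; linarith)
  qed
  then have "(LINT u|lborel. partial_x ?f u * \<Psi> u) = 0" by (rule test)
  moreover have "partial_x ?f u = (bump p q n (fst u) - bump p q n (fst u - s)) * bump c d n (snd u)" for u
    unfolding partial_x_def by (rule DERIV_imp_deriv) (auto intro!: derivative_eq_intros g(2))
  ultimately have "0 = (LINT u|lborel. bump p q n (fst u + 0) * bump c d n (snd u) * \<Psi> u
      - bump p q n (fst u + (- s)) * bump c d n (snd u) * \<Psi> u)"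
    by (simp add: algebra_simps)
  also have "\<dots> = (LINT u|lborel. bump p q n (fst u + 0) * bump c d n (snd u) * \<Psi> u)
      - (LINT u|lborel. bump p q n (fst u + (- s)) * bump c d n (snd u) * \<Psi> u)"
    by (rule Bochner_Integration.integral_diff[OF bdd[OF \<Psi>] bdd[OF \<Psi>]])
  also have "(LINT u|lborel. bump p q n (fst u + (- s)) * bump c d n (snd u) * \<Psi> u) =
      (LINT u|lborel. bump p q n (fst ((s, 0) + u) + (- s)) * bump c d n (snd ((s, 0) + u)) * \<Psi> ((s, 0) + u))"
    by (rule lborel_integral_shift(1)[symmetric]) measurable
  also have "\<dots> = (LINT u|lborel. bump p q n (fst u + 0) * bump c d n (snd u) * \<Psi> ((s, 0) + u))"
    by simp
  also have "(LINT u|lborel. bump p q n (fst u + 0) * bump c d n (snd u) * \<Psi> u) - \<dots> =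
    (LINT u|lborel. bump p q n (fst u + 0) * bump c d n (snd u) * \<Psi> u
      - bump p q n (fst u + 0) * bump c d n (snd u) * \<Psi> ((s, 0) + u))"
    by (rule Bochner_Integration.integral_diff[symmetric, OF bdd[OF \<Psi>] bdd[OF lborel_integral_shift(2)[OF _ \<Psi>]]]) simp
  finally show ?thesis by (simp add: algebra_simps)
qed

text \<open>As \<open>n\<close> grows the bumps become indicators, and the integrands are dominated
  by the absolute value of the difference \<open>D\<close>; so \<open>D\<close> integrates to 0 over
  all admissible boxes.\<close>

lemma AE_shift_invariant:
  fixes \<Psi> :: "real \<times> real \<Rightarrow> real"
  assumes \<Psi>: "integrable lborel \<Psi>"
    and test: "\<And>f. test_fun ({\<alpha><..<\<beta>} \<times> {\<gamma><..<\<delta>}) f \<Longrightarrow> (LINT u|lborel. partial_x f u * \<Psi> u) = 0"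
  shows "AE u in lborel. fst u \<in> {\<alpha><..<\<beta>} \<and> fst u + s \<in> {\<alpha><..<\<beta>} \<and> snd u \<in> {\<gamma><..<\<delta>}
    \<longrightarrow> \<Psi> ((s, 0) + u) = \<Psi> u"
proof -
  have [measurable]: "(fst :: real \<times> real \<Rightarrow> real) \<in> borel_measurable borel"
    "(snd :: real \<times> real \<Rightarrow> real) \<in> borel_measurable borel"
    by (intro borel_measurable_continuous_onI continuous_intros)+
  have [measurable]: "\<Psi> \<in> borel_measurable borel" using \<Psi> by simp
  define D where "D u = \<Psi> u - \<Psi> ((s, 0) + u)" for u
  have D: "integrable lborel D"
    unfolding D_def by (intro Bochner_Integration.integrable_diff \<Psi> lborel_integral_shift(2)) simp
  then have [measurable]: "D \<in> borel_measurable borel" by simp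
  have box0: "(LINT u|lborel. indicator {p<..<q} (fst u) * indicator {c<..<d} (snd u) * D u) = 0"
    if "\<alpha> \<le> p" "\<alpha> \<le> p + s" "q \<le> \<beta>" "q + s \<le> \<beta>" "\<gamma> \<le> c" "d \<le> \<delta>" for p q c d
  proof -
    have "(\<lambda>n. LINT u|lborel. bump p q n (fst u) * bump c d n (snd u) * D u) \<longlonglongrightarrow>
      (LINT u|lborel. indicator {p<..<q} (fst u) * indicator {c<..<d} (snd u) * D u)"
    proof (rule integral_dominated_convergence[where w = "\<lambda>u. \<bar>D u\<bar>"])
      show "integrable lborel (\<lambda>u. \<bar>D u\<bar>)" using D by simp
      show "AE u in lborel. (\<lambda>n. bump p q n (fst u) * bump c d n (snd u) * D u) \<longlonglongrightarrow>
          indicator {p<..<q} (fst u) * indicator {c<..<d} (snd u) * D u"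
        by (intro AE_I2 tendsto_mult tendsto_bump tendsto_const)
      show "AE u in lborel. norm (bump p q n (fst u) * bump c d n (snd u) * D u) \<le> \<bar>D u\<bar>" for n
        by (simp add: abs_mult bump_nonneg bump_le_1 mult_le_one mult_left_le_one_le)
    qed (simp, measurable)
    moreover have ev: "\<forall>\<^sub>F n in sequentially. (LINT u|lborel. bump p q n (fst u) * bump c d n (snd u) * D u) = 0"
      using bump_test_shift_integral[OF \<Psi> test that] unfolding D_def
      by (auto intro: eventually_mono[OF eventually_gt_at_top[of 0]])
    ultimately show ?thesis
      using LIMSEQ_unique tendsto_eventually[OF ev] by blast
  qed
  \<comment> \<open>The truncation selects the points u such that u and u + (s, 0) both lie in the
    rectangle; its intersection with any box is a possibly empty rectangle to which
    \<open>box0\<close> applies.\<close>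
  define F where "F u = indicator {max \<alpha> (\<alpha> - s)<..<min \<beta> (\<beta> - s)} (fst u) * indicator {\<gamma><..<\<delta>} (snd u) * D u"
    for u
  have [measurable]: "F \<in> borel_measurable borel"
    unfolding F_def by measurable
  have "AE u in lborel. F u = 0"
  proof (rule AE_zero_if_box_integrals_zero)
    show "integrable lborel F"
      by (rule Bochner_Integration.integrable_bound[OF D]) (auto simp: F_def indicator_def)
    show "(LINT u:box a b|lborel. F u) = 0" for a b
    proof -
      have "indicator (box a b) u *\<^sub>R F u =
        indicator {max (max \<alpha> (\<alpha> - s)) (fst a)<..<min (min \<beta> (\<beta> - s)) (fst b)} (fst u)
        * indicator {max \<gamma> (snd a)<..<min \<delta> (snd b)} (snd u) * D u" for u
        by (cases a; cases b; cases u) (auto simp: F_def indicator_def box_prod)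
      then show ?thesis
        unfolding set_lebesgue_integral_def by (simp only:) (rule box0; linarith)
    qed
  qed
  then show ?thesis
    by eventually_elim (auto simp: F_def D_def)
qed

section \<open>Vanishing from a zero lateral trace\<close>

lemma AE_lborel_snd:
  assumes "AE z in lborel. P z"
  shows "AE u in (lborel :: (real \<times> real) measure). P (snd u)"
proof -
  obtain N where N: "N \<in> null_sets (lborel :: real measure)" "{z. \<not> P z} \<subseteq> N"
    using assms by (auto elim!: AE_E simp: null_sets_def)
  have "UNIV \<times> N \<in> null_sets ((lborel :: real measure) \<Otimes>\<^sub>M (lborel :: real measure))"
    using N(1) by (intro lborel.times_in_null_sets2) auto
  then show ?thesis
    unfolding lborel_prod by (rule AE_I') (use N in auto)
qed

text \<open>A nonzero value would be carried by the invariance arbitrarily close to the end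
  \<open>e\<close>, against the zero limit there. Rational shifts are dense enough to reach the end,
  and being countable they leave a single null set.\<close>

lemma AE_zero_of_test_and_end_limit:
  fixes \<Psi> :: "real \<times> real \<Rightarrow> real"
  assumes \<Psi>: "integrable lborel \<Psi>" and e: "e = \<alpha> \<or> e = \<beta>"
    and test: "\<And>f. test_fun ({\<alpha><..<\<beta>} \<times> {\<gamma><..<\<delta>}) f \<Longrightarrow> (LINT u|lborel. partial_x f u * \<Psi> u) = 0"
    and lim: "AE z in lborel. z \<in> {\<gamma><..<\<delta>} \<longrightarrow> ((\<lambda>x. \<Psi> (x, z)) \<longlongrightarrow> 0) (at e within {\<alpha><..<\<beta>})"
  shows "AE u in lborel. u \<in> {\<alpha><..<\<beta>} \<times> {\<gamma><..<\<delta>} \<longrightarrow> \<Psi> u = 0"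
proof -
  have "AE u in lborel. \<forall>s\<in>\<rat>. fst u \<in> {\<alpha><..<\<beta>} \<and> fst u + s \<in> {\<alpha><..<\<beta>} \<and> snd u \<in> {\<gamma><..<\<delta>}
    \<longrightarrow> \<Psi> ((s, 0) + u) = \<Psi> u"
    by (intro AE_ball_countable[THEN iffD2] ballI AE_shift_invariant \<Psi> test countable_rat)
  moreover note AE_lborel_snd[OF lim]
  ultimately show ?thesis
  proof eventually_elim
    case (elim u)
    show ?case
    proof (rule impI, rule ccontr)
      assume u: "u \<in> {\<alpha><..<\<beta>} \<times> {\<gamma><..<\<delta>}" and nz: "\<Psi> u \<noteq> 0"
      obtain x z where xz: "u = (x, z)" by (cases u)
      have "((\<lambda>x. \<Psi> (x, z)) \<longlongrightarrow> 0) (at e within {\<alpha><..<\<beta>})"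
        using elim(2) u xz by auto
      then have "\<forall>\<^sub>F y in at e within {\<alpha><..<\<beta>}. \<bar>\<Psi> (y, z)\<bar> < \<bar>\<Psi> u\<bar>"
        using nz by (auto dest: tendstoD[of _ _ _ "\<bar>\<Psi> u\<bar>"])
      then obtain \<eta> where \<eta>: "\<eta> > 0"
        "\<And>y. y \<in> {\<alpha><..<\<beta>} \<Longrightarrow> y \<noteq> e \<Longrightarrow> dist y e < \<eta> \<Longrightarrow> \<bar>\<Psi> (y, z)\<bar> < \<bar>\<Psi> u\<bar>"
        by (auto simp: eventually_at)
      \<comment> \<open>These shifts keep x + s in (\<alpha>, \<beta>) and within \<eta> of
        \<open>e\<close>; since \<open>e\<close> is one of the two ends, the same formula serves
        both.\<close>
      have "max \<alpha> (e - \<eta>) - x < min \<beta> (e + \<eta>) - x" using e u xz \<eta>(1) by auto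
      then obtain s where s: "s \<in> \<rat>" "max \<alpha> (e - \<eta>) - x < s" "s < min \<beta> (e + \<eta>) - x"
        using Rats_dense_in_real by blast
      then have y: "x + s \<in> {\<alpha><..<\<beta>}" "x + s \<noteq> e" "dist (x + s) e < \<eta>"
        using e by (auto simp: dist_real_def)
      from \<eta>(2)[OF this] have "\<bar>\<Psi> (x + s, z)\<bar> < \<bar>\<Psi> u\<bar>" .
      moreover have "\<Psi> (x + s, z) = \<Psi> u"
        using elim(1)[rule_format, OF s(1)] y u xz by (auto simp: add.commute)
      ultimately show False by simp
    qed
  qed
qed

section \<open>Reduction to one half of the domain\<close>

text \<open>The complement of the closed support is open, so \<open>f\<close> vanishes on a
  neighbourhood of \<open>p\<close> within the horizontal line through \<open>p\<close>.\<close>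

lemma partial_x_eq_0_outside:
  assumes "p \<notin> closure {p. f p \<noteq> 0}"
  shows "partial_x f p = 0"
proof -
  let ?A = "- closure {p. f p \<noteq> 0}"
  have "open ((\<lambda>t. (t, snd p)) -` ?A)"
    by (intro open_vimage continuous_intros) auto
  then have "\<forall>\<^sub>F t in nhds (fst p). t \<in> (\<lambda>t. (t, snd p)) -` ?A"
    using assms by (intro eventually_nhds_in_open) auto
  then have "\<forall>\<^sub>F t in nhds (fst p). f (t, snd p) = 0"
  proof (rule eventually_mono)
    fix t assume "t \<in> (\<lambda>t. (t, snd p)) -` ?A"
    then have "(t, snd p) \<notin> closure {p. f p \<noteq> 0}" by simp
    then have "(t, snd p) \<notin> {p. f p \<noteq> 0}" by (rule contrapos_nn) (rule subsetD[OF closure_subset])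
    then show "f (t, snd p) = 0" by simp
  qed
  then have "((\<lambda>t. f (t, snd p)) has_real_derivative 0) (at (fst p))"
    by (subst DERIV_cong_ev[where g = "\<lambda>_. 0"]) auto
  then show ?thesis unfolding partial_x_def by (rule DERIV_imp_deriv)
qed

lemma continuous_partial_x:
  assumes "smooth2 f"
  shows "continuous_on UNIV (partial_x f)"
proof -
  from assms have "smooth2 (partial_x f)" by (cases rule: smooth2.cases) auto
  then have "\<forall>p. partial_x f differentiable (at p)" by (cases rule: smooth2.cases) auto
  then show ?thesis
    by (intro continuous_at_imp_continuous_on ballI differentiable_imp_continuous_within) auto
qed

lemma partial_x_bounded:
  assumes "test_fun U f"
  obtains B where "\<And>p. \<bar>partial_x f p\<bar> \<le> B"
proof -
  let ?K = "closure {p. f p \<noteq> 0}"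
  have "compact (partial_x f ` ?K)"
    using assms continuous_partial_x continuous_on_subset unfolding test_fun_def
    by (intro compact_continuous_image) blast+
  then have "bounded (partial_x f ` ?K)" by (rule compact_imp_bounded)
  then obtain B where "\<forall>y\<in>partial_x f ` ?K. \<bar>y\<bar> \<le> B"
    unfolding bounded_iff real_norm_def by blast
  then have B: "\<bar>partial_x f p\<bar> \<le> B" if "p \<in> ?K" for p using that by blast
  \<comment> \<open>\<open>B\<close> may be negative when the support is empty, hence the maximum
    with 0.\<close>
  have "\<bar>partial_x f p\<bar> \<le> max 0 B" for p
    using B[of p] partial_x_eq_0_outside[of p f] by (cases "p \<in> ?K") auto
  then show ?thesis by (rule that)
qed

text \<open>Finite measure makes the constant 1 integrable on \<open>U\<close>, and |t| <= 1 + t^2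
  gives the domination.\<close>

lemma L2_on_imp_set_integrable:
  assumes "L2_on U f" "U \<in> sets borel" "emeasure lborel U < \<infinity>"
  shows "set_integrable lborel U f"
  unfolding set_integrable_def
proof (rule Bochner_Integration.integrable_bound)
  show "integrable lborel (\<lambda>x. indicator U x + indicator U x *\<^sub>R (f x)\<^sup>2)"
    using assms by (auto simp: L2_on_def set_integrable_def)
  show "(\<lambda>x. indicator U x *\<^sub>R f x) \<in> borel_measurable lborel"
    using assms by (auto simp: L2_on_def set_borel_measurable_def)
  have "\<bar>t\<bar> \<le> 1 + t\<^sup>2" for t :: real
  proof (cases "\<bar>t\<bar> \<le> 1")
    case False
    then have "\<bar>t\<bar> \<le> \<bar>t\<bar>\<^sup>2" by (intro self_le_power) auto
    then show ?thesis by simp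
  qed (use zero_le_power2[of t] in linarith)
  then show "AE x in lborel. norm (indicator U x *\<^sub>R f x) \<le> norm (indicator U x + indicator U x *\<^sub>R (f x)\<^sup>2)"
    by (auto simp: indicator_def)
qed

text \<open>The test functions are supported in one half, away from the line \<open>z = 0\<close>: there the
  representatives are unconstrained, so the integrals over all of \<open>\<Omega>\<close> could take the junk value 0
  because the integrand is not Borel measurable.\<close>

lemma combination_AE_zero_on_half:
  assumes L2: "L2_on ({x0<..<x1} \<times> {\<gamma><..<\<delta>}) \<Phi>" "L2_on ({x0<..<x1} \<times> {\<gamma><..<\<delta>}) \<Phi>'"
    and sub: "-1 \<le> \<gamma>" "\<delta> \<le> 1" and e: "e = x0 \<or> e = x1"
    and lim: "AE z in lborel. z \<in> {\<gamma><..<\<delta>} \<longrightarrow> ((\<lambda>x. \<Phi> (x, z)) \<longlongrightarrow> 0) (at e within {x0<..<x1})"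
      "AE z in lborel. z \<in> {\<gamma><..<\<delta>} \<longrightarrow> ((\<lambda>x. \<Phi>' (x, z)) \<longlongrightarrow> 0) (at e within {x0<..<x1})"
    and dual: "\<And>f. test_fun (Omega x0 x1) f \<Longrightarrow> a * dual_form x0 x1 \<Phi> f + b * dual_form x0 x1 \<Phi>' f = 0"
  shows "AE u in lborel. u \<in> {x0<..<x1} \<times> {\<gamma><..<\<delta>} \<longrightarrow> a * \<Phi> u + b * \<Phi>' u = 0"
proof -
  let ?H = "{x0<..<x1} \<times> {\<gamma><..<\<delta>}"
  have H: "?H \<in> sets borel" "emeasure lborel ?H < \<infinity>"
  proof -
    have H: "?H = box (x0, \<gamma>) (x1, \<delta>)" by (auto simp: box_prod)
    show "?H \<in> sets borel" "emeasure lborel ?H < \<infinity>"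
      unfolding H by (auto simp: emeasure_lborel_box_eq)
  qed
  note int = L2[THEN L2_on_imp_set_integrable, OF H, unfolded set_integrable_def, simplified]
  \<comment> \<open>Extension by 0 makes the combination integrable on the whole plane, where it can
    be translated freely.\<close>
  define \<Psi> where "\<Psi> u = a * (indicator ?H u * \<Phi> u) + b * (indicator ?H u * \<Phi>' u)" for u
  have "AE u in lborel. u \<in> ?H \<longrightarrow> \<Psi> u = 0"
  proof (rule AE_zero_of_test_and_end_limit[OF _ e])
    show "integrable lborel \<Psi>" unfolding \<Psi>_def using int by simp
    have inI: "\<forall>\<^sub>F x in at e within {x0<..<x1}. x \<in> {x0<..<x1}"
      by (auto simp: eventually_at_filter)
    have \<Psi>_lim: "((\<lambda>x. \<Psi> (x, z)) \<longlongrightarrow> 0) (at e within {x0<..<x1})"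
      if "((\<lambda>x. \<Phi> (x, z)) \<longlongrightarrow> 0) (at e within {x0<..<x1})"
        "((\<lambda>x. \<Phi>' (x, z)) \<longlongrightarrow> 0) (at e within {x0<..<x1})" "z \<in> {\<gamma><..<\<delta>}" for z
    proof -
      have "((\<lambda>x. a * \<Phi> (x, z) + b * \<Phi>' (x, z)) \<longlongrightarrow> a * 0 + b * 0) (at e within {x0<..<x1})"
        by (intro tendsto_intros that)
      moreover have "\<forall>\<^sub>F x in at e within {x0<..<x1}. a * \<Phi> (x, z) + b * \<Phi>' (x, z) = \<Psi> (x, z)"
        using inI by eventually_elim (use that(3) in \<open>simp add: \<Psi>_def\<close>)
      ultimately show ?thesis by (simp add: Lim_transform_eventually)
    qed
    show "AE z in lborel. z \<in> {\<gamma><..<\<delta>} \<longrightarrow> ((\<lambda>x. \<Psi> (x, z)) \<longlongrightarrow> 0) (at e within {x0<..<x1})"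
      using lim by eventually_elim (use \<Psi>_lim in blast)
    fix f assume f: "test_fun ?H f"
    have f': "test_fun (Omega x0 x1) f"
      using f sub unfolding test_fun_def Omega_def by fastforce
    \<comment> \<open>Off the half the derivative of \<open>f\<close> is 0, so the two integrands
      coincide at every point, whatever \<phi> is.\<close>
    have form: "dual_form x0 x1 \<phi> f = (LINT u|lborel. partial_x f u * (indicator ?H u * \<phi> u))" for \<phi>
    proof -
      have "partial_x f u = 0" if "u \<notin> ?H" for u
        using f that by (intro partial_x_eq_0_outside) (auto simp: test_fun_def)
      then have "indicator (Omega x0 x1) u *\<^sub>R (partial_x f u * \<phi> u) = partial_x f u * (indicator ?H u * \<phi> u)" for u
        using sub by (cases "u \<in> ?H") (auto simp: Omega_def indicator_def)
      then show ?thesis unfolding dual_form_def set_lebesgue_integral_def by (simp only:)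
    qed
    have fint: "integrable lborel (\<lambda>u. partial_x f u * \<phi> u)" if "integrable lborel \<phi>" for \<phi>
    proof -
      obtain B where B: "\<And>p. \<bar>partial_x f p\<bar> \<le> B" using partial_x_bounded[OF f] by blast
      show ?thesis
      proof (rule Bochner_Integration.integrable_bound)
        show "integrable lborel (\<lambda>u. B * \<phi> u)" using that by simp
        have [measurable]: "partial_x f \<in> borel_measurable borel"
          using f by (intro borel_measurable_continuous_onI continuous_partial_x) (simp add: test_fun_def)
        have [measurable]: "\<phi> \<in> borel_measurable borel" using that by simp
        show "(\<lambda>u. partial_x f u * \<phi> u) \<in> borel_measurable lborel" by (simp, measurable)
        have "\<bar>partial_x f u * \<phi> u\<bar> \<le> \<bar>B * \<phi> u\<bar>" for u
          using B[of u] by (auto simp: abs_mult intro!: mult_right_mono)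
        then show "AE u in lborel. norm (partial_x f u * \<phi> u) \<le> norm (B * \<phi> u)" by simp
      qed
    qed
    have "(LINT u|lborel. partial_x f u * \<Psi> u) =
      (LINT u|lborel. a * (partial_x f u * (indicator ?H u * \<Phi> u)) + b * (partial_x f u * (indicator ?H u * \<Phi>' u)))"
      by (simp add: \<Psi>_def algebra_simps)
    also have "\<dots> = a * dual_form x0 x1 \<Phi> f + b * dual_form x0 x1 \<Phi>' f"
      unfolding form
      by (subst Bochner_Integration.integral_add)
        (simp_all only: integral_mult_right_zero integrable_mult_right fint[OF int(1)] fint[OF int(2)])
    finally show "(LINT u|lborel. partial_x f u * \<Psi> u) = 0"
      using dual[OF f'] by simp
  qed
  then show ?thesis by eventually_elim (auto simp: \<Psi>_def)
qed

section \<open>Vertical lines and jumps\<close>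

text \<open>A nonempty open interval has positive measure, so it cannot lie in the exceptional null
  set.\<close>

lemma AE_lborel_imp_ex_in_interval:
  fixes c d :: real
  assumes "AE x in lborel. P x" "c < d"
  shows "\<exists>x\<in>{c<..<d}. P x"
proof (rule ccontr)
  assume "\<not> ?thesis"
  with assms(1) have "AE x in lborel. x \<notin> {c<..<d}" by (auto elim: eventually_mono)
  then have "{c<..<d} \<in> null_sets lborel" by (subst (asm) AE_iff_null_sets[symmetric]) auto
  then show False using assms(2) by (auto simp: null_sets_def)
qed

text \<open>By continuity a nonzero value would persist on an open interval, and that interval meets
  the full-measure set where \<open>f\<close> vanishes.\<close>

lemma continuous_AE_zero_imp_zero:
  fixes f :: "real \<Rightarrow> real"
  assumes "AE z in lborel. z \<in> {c<..<d} \<longrightarrow> f z = 0"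
    and "\<And>z. z \<in> {c<..<d} \<Longrightarrow> isCont f z" and z: "z \<in> {c<..<d}"
  shows "f z = 0"
proof (rule ccontr)
  assume "f z \<noteq> 0"
  then obtain \<eta> where \<eta>: "\<eta> > 0" "\<And>y. dist z y < \<eta> \<Longrightarrow> f y \<noteq> 0"
    using continuous_at_avoid[of z f 0] assms(2)[OF z] by auto
  have "max c (z - \<eta>) < min d (z + \<eta>)" using z \<eta>(1) by auto
  from AE_lborel_imp_ex_in_interval[OF assms(1) this] \<eta>(2) show False
    by (force simp: dist_real_def)
qed

theorem proposition2p8:
  fixes x0 x1 :: real and Phi0 Phi1 :: "real \<times> real \<Rightarrow> real"
  assumes "x0 < x1"
    and "dual_profile x0 x1 0 Phi0"
    and "dual_profile x0 x1 1 Phi1"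
  shows "\<forall>a b :: real.
           (\<forall>f. test_fun (Omega x0 x1) f \<longrightarrow>
                a * dual_form x0 x1 Phi0 f + b * dual_form x0 x1 Phi1 f = 0)
           \<longrightarrow> a = 0 \<and> b = 0"
proof (intro allI impI)
  fix a b :: real
  assume dual: "\<forall>f. test_fun (Omega x0 x1) f \<longrightarrow>
    a * dual_form x0 x1 Phi0 f + b * dual_form x0 x1 Phi1 f = 0"
  note defs = dual_profile_def Z0_def Omega_plus_def Omega_minus_def
  note p0 = assms(2)[unfolded defs] and p1 = assms(3)[unfolded defs]
  have L2: "L2_on ({x0<..<x1} \<times> {-1<..<0}) Phi0" "L2_on ({x0<..<x1} \<times> {-1<..<0}) Phi1"
    "L2_on ({x0<..<x1} \<times> {0<..<1}) Phi0" "L2_on ({x0<..<x1} \<times> {0<..<1}) Phi1"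
    using p0 p1 by blast+
  \<comment> \<open>Restricting a one-sided limit to the bounded interval puts both lateral ends in
    the common form \<open>at e within {x0<..<x1}\<close>.\<close>
  have endlim: "(g \<longlongrightarrow> 0) (at x0 within {x0<..<x1})" if "(g \<longlongrightarrow> 0) (at_right x0)" for g :: "real \<Rightarrow> real"
    using that by (rule tendsto_within_subset) auto
  have endlim': "(g \<longlongrightarrow> 0) (at x1 within {x0<..<x1})" if "(g \<longlongrightarrow> 0) (at_left x1)" for g :: "real \<Rightarrow> real"
    using that by (rule tendsto_within_subset) auto
  have minus: "AE u in lborel. u \<in> {x0<..<x1} \<times> {-1<..<0} \<longrightarrow> a * Phi0 u + b * Phi1 u = 0"
  proof (rule combination_AE_zero_on_half[where e = x0])
    have "AE z in lborel. -1 < z \<and> z < 0 \<longrightarrow> ((\<lambda>x. Phi0 (x, z)) \<longlongrightarrow> 0) (at_right x0)" using p0 by blast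
    then show "AE z in lborel. z \<in> {-1<..<0} \<longrightarrow> ((\<lambda>x. Phi0 (x, z)) \<longlongrightarrow> 0) (at x0 within {x0<..<x1})"
      by eventually_elim (auto intro: endlim)
    have "AE z in lborel. -1 < z \<and> z < 0 \<longrightarrow> ((\<lambda>x. Phi1 (x, z)) \<longlongrightarrow> 0) (at_right x0)" using p1 by blast
    then show "AE z in lborel. z \<in> {-1<..<0} \<longrightarrow> ((\<lambda>x. Phi1 (x, z)) \<longlongrightarrow> 0) (at x0 within {x0<..<x1})"
      by eventually_elim (auto intro: endlim)
  qed (use L2 dual in auto)
  have plus: "AE u in lborel. u \<in> {x0<..<x1} \<times> {0<..<1} \<longrightarrow> a * Phi0 u + b * Phi1 u = 0"
  proof (rule combination_AE_zero_on_half[where e = x1])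
    have "AE z in lborel. 0 < z \<and> z < 1 \<longrightarrow> ((\<lambda>x. Phi0 (x, z)) \<longlongrightarrow> 0) (at_left x1)" using p0 by blast
    then show "AE z in lborel. z \<in> {0<..<1} \<longrightarrow> ((\<lambda>x. Phi0 (x, z)) \<longlongrightarrow> 0) (at x1 within {x0<..<x1})"
      by eventually_elim (auto intro: endlim')
    have "AE z in lborel. 0 < z \<and> z < 1 \<longrightarrow> ((\<lambda>x. Phi1 (x, z)) \<longlongrightarrow> 0) (at_left x1)" using p1 by blast
    then show "AE z in lborel. z \<in> {0<..<1} \<longrightarrow> ((\<lambda>x. Phi1 (x, z)) \<longlongrightarrow> 0) (at x1 within {x0<..<x1})"
      by eventually_elim (auto intro: endlim')
  qed (use L2 dual in auto)
  \<comment> \<open>\<open>T\<close> packages the conditions near z = 0 on one vertical line, so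
    that both profiles can be examined at the same x.\<close>
  define T where "T \<Phi> j x \<longleftrightarrow> (\<exists>a b c d.
           ((\<lambda>z. \<Phi> (x, z)) \<longlongrightarrow> a) (at_right 0) \<and>
           ((\<lambda>z. \<Phi> (x, z)) \<longlongrightarrow> b) (at_left 0) \<and>
           (\<forall>z \<in> {0<..<1} \<union> {-1<..<0}. (\<lambda>z. \<Phi> (x, z)) differentiable (at z)) \<and>
           ((\<lambda>z. deriv (\<lambda>z. \<Phi> (x, z)) z) \<longlongrightarrow> c) (at_right 0) \<and>
           ((\<lambda>z. deriv (\<lambda>z. \<Phi> (x, z)) z) \<longlongrightarrow> d) (at_left 0) \<and>
           a - b = (if j = 1 then 1 else 0) \<and>
           c - d = (if j = 0 then -1 else 0))"
    for \<Phi> :: "real \<times> real \<Rightarrow> real" and j :: nat and x :: real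
  have T: "AE x in lborel. x0 < x \<and> x < x1 \<longrightarrow> T \<Phi> j x" if "dual_profile x0 x1 j \<Phi>" for \<Phi> j
    using that unfolding dual_profile_def T_def
    by (elim conjE) (erule eventually_mono, blast)
  \<comment> \<open>By Fubini, vanishing almost everywhere on a half passes to almost every vertical
    line.\<close>
  have sec: "AE x in lborel. AE z in lborel. (x, z) \<in> {x0<..<x1} \<times> {c<..<d} \<longrightarrow> a * Phi0 (x, z) + b * Phi1 (x, z) = 0"
    if "AE u in lborel. u \<in> {x0<..<x1} \<times> {c<..<d} \<longrightarrow> a * Phi0 u + b * Phi1 u = 0" for c d :: real
    using that by (intro lborel_pair.AE_pair) (unfold lborel_prod)
  have "AE x in lborel. (x0 < x \<and> x < x1 \<longrightarrow> T Phi0 0 x) \<and> (x0 < x \<and> x < x1 \<longrightarrow> T Phi1 1 x) \<and>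
    (AE z in lborel. (x, z) \<in> {x0<..<x1} \<times> {-1<..<0} \<longrightarrow> a * Phi0 (x, z) + b * Phi1 (x, z) = 0) \<and>
    (AE z in lborel. (x, z) \<in> {x0<..<x1} \<times> {0<..<1} \<longrightarrow> a * Phi0 (x, z) + b * Phi1 (x, z) = 0)"
    by (intro AE_conjI T assms sec minus plus)
  \<comment> \<open>The four full-measure conditions hold jointly, so one abscissa in (x0, x1)
    serves them all.\<close>
  from AE_lborel_imp_ex_in_interval[OF this \<open>x0 < x1\<close>] obtain x where
    T0: "T Phi0 0 x" and T1: "T Phi1 1 x"
    and zm: "AE z in lborel. z \<in> {-1<..<0} \<longrightarrow> a * Phi0 (x, z) + b * Phi1 (x, z) = 0"
    and zp: "AE z in lborel. z \<in> {0<..<1} \<longrightarrow> a * Phi0 (x, z) + b * Phi1 (x, z) = 0"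
    by auto
  define u v w where "u z = Phi0 (x, z)" and "v z = Phi1 (x, z)" and "w z = a * u z + b * v z" for z
  obtain u1 u2 u3 u4 where u: "(u \<longlongrightarrow> u1) (at_right 0)" "(u \<longlongrightarrow> u2) (at_left 0)"
    "\<forall>z \<in> {0<..<1} \<union> {-1<..<0}. u differentiable (at z)"
    "(deriv u \<longlongrightarrow> u3) (at_right 0)" "(deriv u \<longlongrightarrow> u4) (at_left 0)" "u1 - u2 = 0" "u3 - u4 = -1"
    using T0 unfolding T_def u_def by auto
  obtain v1 v2 v3 v4 where v: "(v \<longlongrightarrow> v1) (at_right 0)" "(v \<longlongrightarrow> v2) (at_left 0)"
    "\<forall>z \<in> {0<..<1} \<union> {-1<..<0}. v differentiable (at z)"
    "(deriv v \<longlongrightarrow> v3) (at_right 0)" "(deriv v \<longlongrightarrow> v4) (at_left 0)" "v1 - v2 = 1" "v3 - v4 = 0"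
    using T1 unfolding T_def v_def by auto
  have cont: "isCont w z" if "z \<in> {0<..<1} \<union> {-1<..<0}" for z
    unfolding w_def using u(3) v(3) that
    by (intro continuous_intros differentiable_imp_continuous_within) auto
  have w0: "w z = 0" if "z \<in> {0<..<1} \<union> {-1<..<0}" for z
    using that continuous_AE_zero_imp_zero[of "-1" 0 w z] continuous_AE_zero_imp_zero[of 0 1 w z]
      zm zp cont by (auto simp: w_def u_def v_def)
  \<comment> \<open>Off z = 0 the combination \<open>w\<close> is 0 on an open set, so its
    derivative, computed by linearity, is 0 as well.\<close>
  have w'0: "a * deriv u z + b * deriv v z = 0" if z: "z \<in> {0<..<1} \<union> {-1<..<0}" for z
  proof -
    have "(w has_real_derivative a * deriv u z + b * deriv v z) (at z)"
      unfolding w_def using u(3) v(3) z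
      by (intro DERIV_add DERIV_cmult) (auto simp: DERIV_deriv_iff_real_differentiable)
    moreover have "(w has_real_derivative 0) (at z)"
    proof (subst DERIV_cong_ev[OF refl _ refl])
      have "open ({0<..<1} \<union> {-1<..<0::real})" by auto
      from eventually_nhds_in_open[OF this z] show "\<forall>\<^sub>F z in nhds z. w z = 0"
        by eventually_elim (rule w0)
    qed simp
    ultimately show ?thesis by (rule DERIV_unique)
  qed
  have evr: "\<forall>\<^sub>F z in at_right (0::real). z \<in> {0<..<1} \<union> {-1<..<0}"
    by (auto simp: eventually_at dist_real_def intro!: exI[of _ 1])
  have evl: "\<forall>\<^sub>F z in at_left (0::real). z \<in> {0<..<1} \<union> {-1<..<0}"
    by (auto simp: eventually_at dist_real_def intro!: exI[of _ 1])
  \<comment> \<open>Uniqueness of limits, applied on each side of 0 to \<open>w\<close> and to its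
    derivative, yields four linear relations between the one-sided limits.\<close>
  have lim0: "l = 0" if "(g \<longlongrightarrow> l) F" "\<forall>\<^sub>F z in F. z \<in> {0<..<1} \<union> {-1<..<0}" "F \<noteq> bot"
    "\<And>z. z \<in> {0<..<1} \<union> {-1<..<0} \<Longrightarrow> g z = 0" for g :: "real \<Rightarrow> real" and l F
    using tendsto_unique[OF that(3,1) tendsto_eventually[OF eventually_mono[OF that(2,4)]]] by simp
  have "a * u1 + b * v1 = 0"
    by (rule lim0[OF _ evr _ w0[unfolded w_def]]) (auto intro!: tendsto_intros u v)
  moreover have "a * u2 + b * v2 = 0"
    by (rule lim0[OF _ evl _ w0[unfolded w_def]]) (auto intro!: tendsto_intros u v)
  moreover have "a * u3 + b * v3 = 0"
    by (rule lim0[OF _ evr _ w'0]) (auto intro!: tendsto_intros u v)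
  moreover have "a * u4 + b * v4 = 0"
    by (rule lim0[OF _ evl _ w'0]) (auto intro!: tendsto_intros u v)
  \<comment> \<open>Subtracting the left relations from the right ones leaves the jumps: 0 and -1
    for \<open>u\<close>, 1 and 0 for \<open>v\<close>. The two equations thus read b = 0 and -a =
    0.\<close>
  ultimately have "a * (u1 - u2) + b * (v1 - v2) = 0" "a * (u3 - u4) + b * (v3 - v4) = 0"
    by (simp_all add: algebra_simps)
  then show "a = 0 \<and> b = 0" using u(6,7) v(6,7) by simp
qed

end
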